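(* Let $d,n\ge1$ be integers, let $\mathrm{M}$ be an $n$-dimensional linear subspace of the algebraic dual $\Pi'$ of $\Pi=\Pi(\mathbb{R}^d)$, let $(\lambda_1,\dots,\lambda_n)$ be a graded basis of $\mathrm{M}$, and let $P_S$ be the corresponding Schaback projector on $\Pi$. Then $P_S$ is of minimal degree.
   Context: $\Pi=\Pi(\mathbb{R}^d)$ is the real vector space of all polynomials with real coefficients in $d$ real variables, $\Pi'$ its algebraic dual, and $\Pi_{<k}$ the subspace of polynomials of total degree $<k$ ($\Pi_{<0}=\{0\}$). For $\lambda\in\Pi'$ and a subspace $V\subseteq\Pi$, $\lambda\perp V$ means that $\lambda$ vanishes on $V$, and ${\perp}V:=\{\mu\in\Pi':\mu\perp V\}$. Graded basis: a basis $(\lambda_1,\dots,\lambda_n)$ of $\mathrm{M}$ is called graded (by degree) if, with $\kappa_i:=\max\{k\in\mathbb{Z}_+:\lambda_i\perp\Pi_{<k}\}$, the sequence $(\kappa_1,\dots,\kappa_n)$ is nondecreasing and, for each $k$, the $\lambda_i$ with $\kappa_i\ge k$ form a basis of $\mathrm{M}\cap{\perp}\Pi_{<k}$. Schaback projector: define the polynomials $w_j:x\mapsto\lambda_j\|x-\cdot\|^{2\kappa_j}$, $j=1,\dots,n$, where $\|\cdot\|$ is the Euclidean norm on $\mathbb{R}^d$ and $\lambda_j\|x-\cdot\|^{2\kappa_j}$ is the value of $\lambda_j$ at the polynomial $y\mapsto\|x-y\|^{2\kappa_j}$. Let $\Lambda^{\mathrm t}:\Pi\to\mathbb{R}^n$,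 $p\mapsto(\lambda_ip)_{i=1}^n$, and $W:\mathbb{R}^n\to\Pi$, $a\mapsto\sum_ja(j)w_j$. The matrix $\Lambda^{\mathrm t}W=(\lambda_iw_j)_{i,j=1}^n$ is invertible, and $P_S:=W(\Lambda^{\mathrm t}W)^{-1}\Lambda^{\mathrm t}$; it is the linear projector that associates with each $p\in\Pi$ the unique $f\in F:=\operatorname{ran}W=\operatorname{span}(w_1,\dots,w_n)$ that satisfies $\mu f=\mu p$ for all $\mu\in\mathrm{M}$. Correctness: for a linear subspace $\mathrm{N}$ of $\Pi'$, a linear subspace $G$ of $\Pi$ is correct for $\mathrm{N}$ if, for every $p\in\Pi$, there is exactly one $g\in G$ with $\mu g=\mu p$ for all $\mu\in\mathrm{N}$. Minimal degree: a finite-rank linear projector $P$ on $\Pi$ is of minimal degree if $$\dim(G\cap\Pi_{<k})\le\dim(\operatorname{ran}P\cap\Pi_{<k}),\qquad k\in\mathbb{N},$$ for all linear subspaces $G$ of $\Pi$ that are correct for ${\perp}\ker P$. (For $P=P_S$, ${\perp}\ker P_S=\mathrm{M}$.) *)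

theory Defs
  imports "HOL-Analysis.Analysis" "HOL-Library.Function_Algebras"
begin

subsection \<open>Pointwise real vector space structure on functions\<close>

text \<open>Needed in order to speak of subspaces, bases and dimensions of sets of linear functionals
  with the library's notions.\<close>

instantiation "fun" :: (type, scaleR) scaleR
begin

definition "c *\<^sub>R f = (\<lambda>x. c *\<^sub>R f x)"

instance ..

end

lemma scaleR_fun_apply [simp]: "(c *\<^sub>R f) x = c *\<^sub>R f x"
  by (simp add: scaleR_fun_def)

instance "fun" :: (type, real_vector) real_vector
  by standard (simp_all add: fun_eq_iff scaleR_add_right scaleR_add_left)


subsection \<open>The space of polynomials\<close>

text \<open>Over the reals, polynomials in finitely many variables and polynomial functions are the
  same thing. The number of variables is \<^term>\<open>CARD('d)\<close>.\<close>

typedef (overloaded) 'd rpoly =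
  "{p :: real ^ 'd::finite \<Rightarrow> real. real_polynomial_function p}"
  morphisms poly_at Rpoly
  by blast

setup_lifting type_definition_rpoly

instantiation rpoly :: (finite) real_vector
begin

lift_definition zero_rpoly :: "'a rpoly" is "\<lambda>x. 0" by blast
lift_definition plus_rpoly :: "'a rpoly \<Rightarrow> 'a rpoly \<Rightarrow> 'a rpoly" is "\<lambda>p q x. p x + q x" by blast
lift_definition minus_rpoly :: "'a rpoly \<Rightarrow> 'a rpoly \<Rightarrow> 'a rpoly" is "\<lambda>p q x. p x - q x" by blast
lift_definition uminus_rpoly :: "'a rpoly \<Rightarrow> 'a rpoly" is "\<lambda>p x. - p x" by blast
lift_definition scaleR_rpoly :: "real \<Rightarrow> 'a rpoly \<Rightarrow> 'a rpoly" is "\<lambda>c p x. c * p x"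
  by (intro real_polynomial_function.intros(4) real_polynomial_function.intros(2))

instance
  by standard (transfer; simp add: fun_eq_iff algebra_simps)+

end

lift_definition monomial :: "('d \<Rightarrow> nat) \<Rightarrow> 'd::finite rpoly"
  is "\<lambda>\<alpha> x. \<Prod>i\<in>UNIV. (x $ i) ^ \<alpha> i"
  by (intro real_polynomial_function_prod real_polynomial_function_power
      real_polynomial_function.intros(1) bounded_linear_vec_nth) auto

definition poly_less :: "nat \<Rightarrow> 'd::finite rpoly set"
  where "poly_less k = span {monomial \<alpha> | \<alpha>. (\<Sum>i\<in>UNIV. \<alpha> i) < k}"


subsection \<open>Linear functionals\<close>

definition alg_dual :: "('v::real_vector \<Rightarrow> real) set"
  where "alg_dual = {\<mu>. linear \<mu>}"

definition annihilator :: "'v::real_vector set \<Rightarrow> ('v \<Rightarrow> real) set"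
  where "annihilator V = {\<mu> \<in> alg_dual. \<forall>p\<in>V. \<mu> p = 0}"

text \<open>For a nonzero linear functional the set below is finite, so \<^const>\<open>Max\<close> is meaningful;
  it contains \<open>0\<close> because \<^term>\<open>poly_less 0 = {0}\<close>.\<close>

definition kappa :: "('d::finite rpoly \<Rightarrow> real) \<Rightarrow> nat"
  where "kappa l = Max {k. l \<in> annihilator (poly_less k)}"

definition is_basis :: "('i \<Rightarrow> 'v::real_vector) \<Rightarrow> 'i set \<Rightarrow> 'v set \<Rightarrow> bool"
  where "is_basis b I V \<longleftrightarrow> inj_on b I \<and> independent (b ` I) \<and> span (b ` I) = V"

definition graded_basis ::
    "('n::{finite,linorder} \<Rightarrow> 'd::finite rpoly \<Rightarrow> real) \<Rightarrow> ('d rpoly \<Rightarrow> real) set \<Rightarrow> bool"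
  where "graded_basis l M \<longleftrightarrow>
    is_basis l UNIV M \<and>
    mono (\<lambda>i. kappa (l i)) \<and>
    (\<forall>k. is_basis l {i. kappa (l i) \<ge> k} (M \<inter> annihilator (poly_less k)))"


subsection \<open>The Schaback projector\<close>

lift_definition dist_poly :: "nat \<Rightarrow> real ^ 'd \<Rightarrow> 'd::finite rpoly"
  is "\<lambda>k x y. norm (x - y) ^ (2 * k)"
proof -
  fix k and x :: "real ^ 'd"
  have "real_polynomial_function (\<lambda>y. (\<Sum>i\<in>UNIV. (x $ i - y $ i)\<^sup>2) ^ k)"
    by (intro real_polynomial_function_power real_polynomial_function_sum
        real_polynomial_function_diff real_polynomial_function.intros(2)
        real_polynomial_function.intros(1) bounded_linear_vec_nth) auto
  then show "real_polynomial_function (\<lambda>y. norm (x - y) ^ (2 * k))"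
    by (simp add: power_mult norm_vec_def L2_set_def sum_nonneg)
qed

definition schaback_w :: "('d::finite rpoly \<Rightarrow> real) \<Rightarrow> 'd rpoly"
  where "schaback_w l = Rpoly (\<lambda>x. l (dist_poly (kappa l) x))"

text \<open>The function passed to \<^const>\<open>Rpoly\<close> is indeed a polynomial: \<open>(x, y) \<mapsto> \<parallel>x - y\<parallel>\<^sup>2\<^sup>k\<close> is a
  finite sum of products of a polynomial in \<open>x\<close> and a polynomial in \<open>y\<close>.\<close>

inductive separable :: "(real ^ 'd::finite \<Rightarrow> real ^ 'd \<Rightarrow> real) \<Rightarrow> bool" where
  prod: "real_polynomial_function f \<Longrightarrow> real_polynomial_function g \<Longrightarrow> separable (\<lambda>x y. f x * g y)"
| add: "separable F \<Longrightarrow> separable G \<Longrightarrow> separable (\<lambda>x y. F x y + G x y)"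

lemma separable_mult_prod:
  assumes "separable F" "real_polynomial_function f" "real_polynomial_function g"
  shows "separable (\<lambda>x y. F x y * (f x * g y))"
  using assms(1)
proof induction
  case (prod f' g')
  have "separable (\<lambda>x y. (f' x * f x) * (g' y * g y))"
    using prod assms(2,3) by (intro separable.prod real_polynomial_function.intros(4))
  then show ?case by (simp add: mult_ac)
next
  case (add F G)
  then show ?case using separable.add by (simp add: distrib_right)
qed

lemma separable_mult:
  assumes "separable F" "separable G"
  shows "separable (\<lambda>x y. F x y * G x y)"
  using assms(2)
proof induction
  case (prod f g)
  then show ?case using separable_mult_prod[OF assms(1)] by blast
next
  case (add G H)
  then show ?case using separable.add by (simp add: distrib_left)
qed

lemma separable_const: "separable (\<lambda>x y. c)"
  using separable.prod[OF real_polynomial_function.intros(2)[of c] real_polynomial_function.intros(2)[of 1]]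
  by simp

lemma separable_sum:
  "finite I \<Longrightarrow> (\<And>i. i \<in> I \<Longrightarrow> separable (F i)) \<Longrightarrow> separable (\<lambda>x y. \<Sum>i\<in>I. F i x y)"
  by (induction I rule: finite_induct) (auto intro: separable_const separable.add)

lemma separable_power: "separable F \<Longrightarrow> separable (\<lambda>x y. F x y ^ k)"
  by (induction k) (auto intro: separable_const separable_mult)

lemma separable_dist: "separable (\<lambda>x y :: real ^ 'd::finite. norm (x - y) ^ (2 * k))"
proof -
  have coord: "real_polynomial_function (\<lambda>x :: real ^ 'd. c * x $ i)" for c i
    by (intro real_polynomial_function.intros(4) real_polynomial_function.intros(2)
        real_polynomial_function.intros(1) bounded_linear_vec_nth)
  have "separable (\<lambda>x y :: real ^ 'd. (1 * x $ i) * 1 + 1 * (- 1 * y $ i))" for i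
    by (intro separable.add separable.prod coord real_polynomial_function.intros(2))
  then have "separable (\<lambda>x y :: real ^ 'd. x $ i - y $ i)" for i
    by simp
  then have "separable (\<lambda>x y :: real ^ 'd. (\<Sum>i\<in>UNIV. (x $ i - y $ i)\<^sup>2) ^ k)"
    by (intro separable_power separable_sum) auto
  then show ?thesis
    by (simp add: power_mult norm_vec_def L2_set_def sum_nonneg)
qed

lemma separable_linear:
  fixes l :: "'d::finite rpoly \<Rightarrow> real"
  assumes "separable F" "linear l"
  shows "(\<forall>x. real_polynomial_function (F x)) \<and> real_polynomial_function (\<lambda>x. l (Rpoly (F x)))"
  using assms(1)
proof induction
  case (prod f g)
  have "Rpoly (\<lambda>y. f x * g y) = f x *\<^sub>R Rpoly g" for x
    using prod by (simp add: scaleR_rpoly.abs_eq eq_onp_same_args)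
  then have "l (Rpoly (\<lambda>y. f x * g y)) = f x * l (Rpoly g)" for x
    using linear_scale[OF assms(2)] by simp
  then show ?case using prod by auto
next
  case (add F G)
  have "Rpoly (\<lambda>y. F x y + G x y) = Rpoly (F x) + Rpoly (G x)" for x
    using add by (simp add: plus_rpoly.abs_eq eq_onp_same_args)
  then have "l (Rpoly (\<lambda>y. F x y + G x y)) = l (Rpoly (F x)) + l (Rpoly (G x))" for x
    using linear_add[OF assms(2)] by simp
  then show ?case using add by auto
qed

lemma poly_at_schaback_w:
  fixes l :: "'d::finite rpoly \<Rightarrow> real"
  assumes "linear l"
  shows "poly_at (schaback_w l) x = l (dist_poly (kappa l) x)"
proof -
  have "real_polynomial_function (\<lambda>x. l (Rpoly (poly_at (dist_poly (kappa l) x))))"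
    unfolding dist_poly.rep_eq using separable_linear[OF separable_dist assms] by blast
  then have "real_polynomial_function (\<lambda>x. l (dist_poly (kappa l) x))"
    unfolding poly_at_inverse .
  then show ?thesis
    by (simp add: schaback_w_def Rpoly_inverse)
qed

definition data_map :: "('n::finite \<Rightarrow> 'd::finite rpoly \<Rightarrow> real) \<Rightarrow> 'd rpoly \<Rightarrow> real ^ 'n"
  where "data_map l p = (\<chi> i. l i p)"

definition schaback_W :: "('n::finite \<Rightarrow> 'd::finite rpoly \<Rightarrow> real) \<Rightarrow> real ^ 'n \<Rightarrow> 'd rpoly"
  where "schaback_W l a = (\<Sum>j\<in>UNIV. (a $ j) *\<^sub>R schaback_w (l j))"

definition schaback_gram :: "('n::finite \<Rightarrow> 'd::finite rpoly \<Rightarrow> real) \<Rightarrow> real ^ 'n ^ 'n"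
  where "schaback_gram l = (\<chi> i j. l i (schaback_w (l j)))"

definition schaback_projector ::
    "('n::finite \<Rightarrow> 'd::finite rpoly \<Rightarrow> real) \<Rightarrow> 'd rpoly \<Rightarrow> 'd rpoly"
  where "schaback_projector l p = schaback_W l (matrix_inv (schaback_gram l) *v data_map l p)"


subsection \<open>Minimal degree\<close>

definition correct_for :: "'v::real_vector set \<Rightarrow> ('v \<Rightarrow> real) set \<Rightarrow> bool"
  where "correct_for G N \<longleftrightarrow> (\<forall>p. \<exists>!g. g \<in> G \<and> (\<forall>\<mu>\<in>N. \<mu> g = \<mu> p))"

definition finite_rank_projector :: "('v::real_vector \<Rightarrow> 'v) \<Rightarrow> bool"
  where "finite_rank_projector P \<longleftrightarrow>
    linear P \<and> P \<circ> P = P \<and> (\<exists>B. finite B \<and> range P = span B)"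

definition minimal_degree :: "('d::finite rpoly \<Rightarrow> 'd rpoly) \<Rightarrow> bool"
  where "minimal_degree P \<longleftrightarrow>
    finite_rank_projector P \<and>
    (\<forall>G. subspace G \<longrightarrow> correct_for G (annihilator {p. P p = 0}) \<longrightarrow>
      (\<forall>k. dim (G \<inter> poly_less k) \<le> dim (range P \<inter> poly_less k)))"

end

(*
  Expanding |x - y|^(2k) = (|x|^2 - 2 x.y + |y|^2)^k gives terms |x|^(2a) (x.y)^b |y|^(2c) with
  a + b + c = k. If the functional vanishes in degrees < k, only terms with c >= a survive, so w_j
  has degree at most kappa_j. If both functionals vanish in degrees < k, only a = c survives, so b
  has the parity of k and (-1)^k times the resulting bilinear form is a sum of squares, among which
  (a = 0) all values on monomials of degree k occur. Hence the Gram matrix is block triangular with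
  definite diagonal blocks, and invertible.

  For minimal degree, compare both sides with N = #{j. kappa_j < k}: the N independent polynomials
  w_j with kappa_j < k lie in ran P and have degree < k, while for correct G the data map is
  injective on G and has at most N nonzero components on polynomials of degree < k.
*)
theory Submission
  imports Defs
begin

section \<open>Monomials span the space of polynomials\<close>

lemma linear_poly_at: "linear poly_at"
  by (rule linearI) (simp_all add: fun_eq_iff plus_rpoly.rep_eq scaleR_rpoly.rep_eq)

lemma sum_fun_apply: "(\<Sum>i\<in>I. f i) x = (\<Sum>i\<in>I. f i x)"
  by (induction I rule: infinite_finite_induct) auto

lemma poly_at_sum: "poly_at (\<Sum>i\<in>I. f i) x = (\<Sum>i\<in>I. poly_at (f i) x)"
  by (simp add: linear_sum[OF linear_poly_at] sum_fun_apply)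

lemma rpoly_eqI: "(\<And>x. poly_at p x = poly_at q x) \<Longrightarrow> p = q"
  by (simp add: poly_at_inject[symmetric] fun_eq_iff)

lemma monomial_mult:
  "poly_at (monomial \<alpha>) x * poly_at (monomial \<beta>) x = poly_at (monomial (\<lambda>i. \<alpha> i + \<beta> i)) x"
  by (simp add: monomial.rep_eq power_add prod.distrib)

text \<open>Products of monomials are monomials, and multiplication is bilinear: one span induction
  extends this in the second factor, another in the first.\<close>

lemma span_monomials_mult:
  fixes f g :: "real ^ 'd::finite \<Rightarrow> real"
  assumes "f \<in> span (range (\<lambda>\<alpha>. poly_at (monomial \<alpha>)))"
    and "g \<in> span (range (\<lambda>\<alpha>. poly_at (monomial \<alpha>)))"
  shows "(\<lambda>x. f x * g x) \<in> span (range (\<lambda>\<alpha>. poly_at (monomial \<alpha>)))" (is "_ \<in> span ?S")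
proof -
  have 1: "(\<lambda>x. poly_at (monomial \<alpha>) x * g x) \<in> span ?S" for \<alpha>
    using assms(2)
  proof (induction rule: span_induct_alt)
    case base
    show ?case using span_zero[of ?S] by (simp add: zero_fun_def)
  next
    case (step c p q)
    obtain \<beta> where "p = poly_at (monomial \<beta>)" using step by auto
    then have "(\<lambda>x. poly_at (monomial \<alpha>) x * p x) \<in> span ?S"
      by (auto simp: monomial_mult intro: span_base)
    then have "c *\<^sub>R (\<lambda>x. poly_at (monomial \<alpha>) x * p x) + (\<lambda>x. poly_at (monomial \<alpha>) x * q x) \<in> span ?S"
      using step by (intro span_add span_scale)
    then show ?case by (simp add: plus_fun_def scaleR_fun_def algebra_simps)
  qed
  show ?thesis
    using assms(1)
  proof (induction rule: span_induct_alt)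
    case base
    show ?case using span_zero[of ?S] by (simp add: zero_fun_def)
  next
    case (step c p q)
    then have "c *\<^sub>R (\<lambda>x. p x * g x) + (\<lambda>x. q x * g x) \<in> span ?S"
      using 1 by (intro span_add span_scale) auto
    then show ?case by (simp add: plus_fun_def scaleR_fun_def algebra_simps)
  qed
qed

text \<open>Follows the inductive generation of polynomial functions: a linear map is a combination
  of the coordinates, a constant is a multiple of the monomial with exponent 0, and the span is
  closed under products. The claim is about functions because the induction lives there; injectivity
  of \<open>poly_at\<close> carries it over to \<open>rpoly\<close>.\<close>

lemma real_polynomial_function_in_span_monomials:
  fixes p :: "real ^ 'd::finite \<Rightarrow> real"
  assumes "real_polynomial_function p"
  shows "p \<in> span (range (\<lambda>\<alpha>. poly_at (monomial \<alpha>)))" (is "p \<in> span ?S")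
  using assms
proof induction
  case (linear f)
  have coord: "poly_at (monomial (\<lambda>j. if j = i then 1 else 0)) x = x $ i" for x :: "real ^ 'd" and i
    by (simp add: monomial.rep_eq if_distrib[of "power _"] prod.delta cong: if_cong)
  have "f x = (\<Sum>i\<in>UNIV. f (axis i 1) *\<^sub>R poly_at (monomial (\<lambda>j. if j = i then 1 else 0))) x" for x
  proof -
    have "f x = f (\<Sum>i\<in>UNIV. x $ i *\<^sub>R axis i 1)"
      using basis_expansion[of x] by (simp add: scalar_mult_eq_scaleR)
    also have "\<dots> = (\<Sum>i\<in>UNIV. x $ i * f (axis i 1))"
      using linear by (simp add: linear_sum bounded_linear.linear linear_scale)
    finally show ?thesis
      by (simp add: sum_fun_apply coord mult.commute)
  qed
  then have "f = (\<Sum>i\<in>UNIV. f (axis i 1) *\<^sub>R poly_at (monomial (\<lambda>j. if j = i then 1 else 0)))"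
    by (rule ext)
  also have "\<dots> \<in> span ?S"
    by (intro span_sum span_scale span_base) auto
  finally show ?case .
next
  case (const c)
  have "(\<lambda>x. c) = c *\<^sub>R poly_at (monomial (\<lambda>i::'d. 0))"
    by (simp add: fun_eq_iff monomial.rep_eq)
  then show ?case by (simp only:) (intro span_scale span_base rangeI)
next
  case (add f g)
  then show ?case using span_add[of f ?S g] by (simp add: plus_fun_def)
next
  case (mult f g)
  then show ?case by (intro span_monomials_mult)
qed

lemma span_monomials: "span (range monomial) = (UNIV :: 'd::finite rpoly set)"
proof -
  have "p \<in> span (range monomial)" for p :: "'d rpoly"
  proof -
    have "poly_at p \<in> span (poly_at ` range monomial)"
      using real_polynomial_function_in_span_monomials[of "poly_at p"] poly_at[of p]
      by (simp add: image_image)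
    then have "poly_at p \<in> poly_at ` span (range monomial)"
      by (simp add: linear_span_image[OF linear_poly_at])
    then show ?thesis by (auto simp: poly_at_inject)
  qed
  then show ?thesis by auto
qed

section \<open>Degree filtration and annihilators\<close>

lemma poly_less_mono: "j \<le> k \<Longrightarrow> poly_less j \<subseteq> poly_less k"
  unfolding poly_less_def by (rule span_mono) auto

lemma finite_dim_poly_less: "\<exists>B. finite B \<and> poly_less k = span (B :: 'd::finite rpoly set)"
proof -
  \<comment> \<open>Each single exponent is at most the total degree, so the exponent vectors lie in
    a finite box.\<close>
  have "{\<alpha> :: 'd \<Rightarrow> nat. (\<Sum>i\<in>UNIV. \<alpha> i) < k} \<subseteq> PiE UNIV (\<lambda>_. {..<k})"
    by (auto simp: PiE_def intro: le_less_trans[OF member_le_sum[of _ UNIV]])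
  then have "finite {\<alpha> :: 'd \<Rightarrow> nat. (\<Sum>i\<in>UNIV. \<alpha> i) < k}"
    by (rule finite_subset) (simp add: finite_PiE)
  moreover have "{monomial \<alpha> | \<alpha> :: 'd \<Rightarrow> nat. (\<Sum>i\<in>UNIV. \<alpha> i) < k} =
      monomial ` {\<alpha>. (\<Sum>i\<in>UNIV. \<alpha> i) < k}" by auto
  ultimately show ?thesis
    unfolding poly_less_def by (metis finite_imageI)
qed

lemma annihilator_poly_less_iff:
  "\<mu> \<in> annihilator (poly_less k) \<longleftrightarrow>
    linear \<mu> \<and> (\<forall>\<alpha>. (\<Sum>i\<in>UNIV. \<alpha> i) < k \<longrightarrow> \<mu> (monomial \<alpha>) = 0)"
proof
  assume "linear \<mu> \<and> (\<forall>\<alpha>. (\<Sum>i\<in>UNIV. \<alpha> i) < k \<longrightarrow> \<mu> (monomial \<alpha>) = 0)"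
  then show "\<mu> \<in> annihilator (poly_less k)"
    using linear_eq_0_on_span[of \<mu> "{monomial \<alpha> | \<alpha>. (\<Sum>i\<in>UNIV. \<alpha> i) < k}"]
    unfolding annihilator_def alg_dual_def poly_less_def by blast
qed (auto simp: annihilator_def alg_dual_def poly_less_def intro: span_base)

lemma subspace_annihilator: "subspace (annihilator V)"
  unfolding subspace_def annihilator_def alg_dual_def
  by (auto simp: linear_iff algebra_simps)

text \<open>\<open>kappa\<close> is a maximum over a set that has to be finite and nonempty. A
  nonzero functional is nonzero at some monomial, whose degree bounds this set, and 0 always belongs
  to it.\<close>

lemma annihilator_kappa:
  assumes "linear \<mu>" "\<mu> \<noteq> 0"
  shows "\<mu> \<in> annihilator (poly_less (kappa \<mu>))"
proof -
  have "\<exists>\<alpha>. \<mu> (monomial \<alpha>) \<noteq> 0"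
  proof (rule ccontr)
    assume "\<not> ?thesis"
    then have "\<mu> p = 0" for p
      using span_monomials by (auto intro: linear_eq_0_on_span[OF assms(1), of "range monomial"])
    then show False using assms(2) by (auto simp: fun_eq_iff)
  qed
  then obtain \<alpha> where "\<mu> (monomial \<alpha>) \<noteq> 0" ..
  then have "{k. \<mu> \<in> annihilator (poly_less k)} \<subseteq> {..(\<Sum>i\<in>UNIV. \<alpha> i)}"
    by (auto simp: annihilator_poly_less_iff not_less[symmetric])
  moreover have "0 \<in> {k. \<mu> \<in> annihilator (poly_less k)}"
    using assms(1) by (simp add: annihilator_poly_less_iff)
  ultimately have "Max {k. \<mu> \<in> annihilator (poly_less k)} \<in> {k. \<mu> \<in> annihilator (poly_less k)}"
    by (intro Max_in) (auto intro: finite_subset)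
  then show ?thesis by (simp add: kappa_def)
qed


subsection \<open>Expansion of powers of the squared distance\<close>

text \<open>Words index the fully expanded power of an inner product. Different words may give the
  same monomial, which avoids multinomial coefficients.\<close>

definition words :: "nat \<Rightarrow> 'a list set"
  where "words n = {w. length w = n}"

lemma words_0: "words 0 = {[]}"
  by (auto simp: words_def)

lemma finite_words: "finite (words n :: 'a::finite list set)"
  using finite_lists_length_eq[of "UNIV :: 'a set" n] by (simp add: words_def)

lemma sum_words_Suc:
  "(\<Sum>w\<in>words (Suc n). f w) = (\<Sum>i\<in>UNIV. \<Sum>w\<in>words n. f ((i::'a::finite) # w))"
proof -
  have "(words (Suc n) :: 'a list set) = (\<lambda>(i, w). i # w) ` (UNIV \<times> words n)"
    by (auto simp: words_def length_Suc_conv image_iff)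
  then have "(\<Sum>w\<in>words (Suc n). f w) = (\<Sum>(i, w)\<in>UNIV \<times> words n. f (i # w))"
    by (simp add: sum.reindex inj_on_def case_prod_unfold)
  then show ?thesis by (simp add: sum.cartesian_product)
qed

definition word_eval :: "'d list \<Rightarrow> real ^ 'd::finite \<Rightarrow> real"
  where "word_eval w x = (\<Prod>i\<leftarrow>w. x $ i)"

lemma word_eval_simps [simp]:
  "word_eval [] x = 1" "word_eval (i # w) x = x $ i * word_eval w x"
  by (simp_all add: word_eval_def)

lemma word_eval_eq_monomial: "word_eval w x = poly_at (monomial (count_list w)) x"
proof (induction w)
  case (Cons i w)
  have "(\<Prod>j\<in>UNIV. (x $ j) ^ count_list (i # w) j) =
      (\<Prod>j\<in>UNIV. (if j = i then x $ j else 1) * (x $ j) ^ count_list w j)"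
    by (rule prod.cong) auto
  also have "\<dots> = x $ i * (\<Prod>j\<in>UNIV. (x $ j) ^ count_list w j)"
    by (simp add: prod.distrib prod.delta)
  finally show ?case using Cons by (simp add: monomial.rep_eq)
qed (simp add: monomial.rep_eq)

lemma inner_power_words:
  fixes x y :: "real ^ 'd::finite"
  shows "(x \<bullet> y) ^ n = (\<Sum>w\<in>words n. word_eval w x * word_eval w y)"
proof (induction n)
  case (Suc n)
  have "(x \<bullet> y) ^ Suc n = (\<Sum>i\<in>UNIV. x $ i * y $ i) * (\<Sum>w\<in>words n. word_eval w x * word_eval w y)"
    using Suc by (simp add: inner_vec_def)
  then show ?case
    by (simp add: sum_words_Suc sum_product mult_ac)
qed (simp add: words_0)

text \<open>The common shape of the x-factor and the y-factor of every term in the expansion: a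
  power of the squared norm times the monomial of a word.\<close>

lift_definition radial :: "nat \<Rightarrow> 'd list \<Rightarrow> 'd::finite rpoly"
  is "\<lambda>a w x. (norm x ^ 2) ^ a * word_eval w x"
proof -
  fix a and w :: "'d list"
  have "real_polynomial_function (\<lambda>x :: real ^ 'd. (norm x ^ 2) ^ a)"
    using dist_poly.rep_eq[of a "0 :: real ^ 'd"] poly_at[of "dist_poly a (0 :: real ^ 'd)"]
    by (simp add: power_mult)
  moreover have "real_polynomial_function (word_eval w :: real ^ 'd \<Rightarrow> real)"
    using poly_at[of "monomial (count_list w)"] by (simp add: word_eval_eq_monomial[abs_def])
  ultimately show "real_polynomial_function (\<lambda>x. (norm x ^ 2) ^ a * word_eval w x)"
    by (rule real_polynomial_function.intros(4))
qed

lemma radial_0: "radial 0 w = monomial (count_list w)"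
  by (rule rpoly_eqI) (simp add: radial.rep_eq word_eval_eq_monomial)

text \<open>One factor |x|^2 is traded for a doubled letter, summed over all letters. The quantity
  2a + length w stays fixed, so the degree bound follows by induction on a.\<close>

lemma radial_Suc: "radial (Suc a) w = (\<Sum>i\<in>UNIV. radial a (i # i # w))"
proof (rule rpoly_eqI)
  fix x :: "real ^ 'a"
  have "norm x ^ 2 = (\<Sum>i\<in>UNIV. x $ i * x $ i)"
    unfolding power2_norm_eq_inner by (simp add: inner_vec_def)
  then show "poly_at (radial (Suc a) w) x = poly_at (\<Sum>i\<in>UNIV. radial a (i # i # w)) x"
    by (simp add: poly_at_sum radial.rep_eq sum_distrib_left sum_distrib_right mult_ac)
qed

lemma sum_count_list: "(\<Sum>i\<in>UNIV. count_list w (i::'a::finite)) = length w"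
  using sum_count_set[of w UNIV] by simp

lemma radial_in_poly_less: "2 * a + length w < k \<Longrightarrow> radial a w \<in> poly_less k"
proof (induction a arbitrary: w)
  case 0
  then show ?case
    unfolding poly_less_def radial_0
    by (intro span_base) (auto intro!: exI[of _ "count_list w"] simp: sum_count_list)
next
  case (Suc a)
  then have "radial a (i # i # w) \<in> poly_less k" for i by simp
  then show ?case
    unfolding radial_Suc poly_less_def by (intro span_sum)
qed

text \<open>The binomial theorem is applied twice: first to split off the power b of the inner
  product, then to the power k - b of |x|^2 + |y|^2.\<close>

lemma dist_power_expansion:
  fixes x y :: "real ^ 'd::finite"
  shows "norm (x - y) ^ (2 * k) =
    (\<Sum>b\<le>k. \<Sum>a\<le>k - b. \<Sum>w\<in>words b. (real (k choose b) * real ((k - b) choose a) * (- 2) ^ b) *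
      (poly_at (radial a w) x * poly_at (radial (k - b - a) w) y))"
proof -
  have "norm (x - y) ^ 2 = (- 2) * (x \<bullet> y) + (norm x ^ 2 + norm y ^ 2)"
    by (simp add: power2_norm_eq_inner inner_diff_left inner_diff_right inner_commute)
  then have "norm (x - y) ^ (2 * k) = ((- 2) * (x \<bullet> y) + (norm x ^ 2 + norm y ^ 2)) ^ k"
    by (simp add: power_mult)
  also have "\<dots> = (\<Sum>b\<le>k. real (k choose b) * ((- 2) * (x \<bullet> y)) ^ b *
      (norm x ^ 2 + norm y ^ 2) ^ (k - b))"
    by (rule binomial_ring)
  also have "\<dots> = (\<Sum>b\<le>k. \<Sum>a\<le>k - b. \<Sum>w\<in>words b.
      (real (k choose b) * real ((k - b) choose a) * (- 2) ^ b) *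
      (poly_at (radial a w) x * poly_at (radial (k - b - a) w) y))"
    unfolding binomial_ring power_mult_distrib inner_power_words
    by (simp only: sum_distrib_left sum_distrib_right sum_product radial.rep_eq mult_ac)
  finally show ?thesis .
qed

section \<open>Kernel polynomials: degree bound and definiteness\<close>

definition kernel_poly :: "nat \<Rightarrow> ('d::finite rpoly \<Rightarrow> real) \<Rightarrow> 'd rpoly"
  where "kernel_poly k \<mu> = (\<Sum>b\<le>k. \<Sum>a\<le>k - b. \<Sum>w\<in>words b.
    (real (k choose b) * real ((k - b) choose a) * (- 2) ^ b * \<mu> (radial (k - b - a) w)) *\<^sub>R radial a w)"

text \<open>For fixed x the expansion is a finite linear combination of polynomials in y, so the
  functional may be applied term by term.\<close>

lemma schaback_w_eq_kernel_poly:
  fixes \<mu> :: "'d::finite rpoly \<Rightarrow> real"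
  assumes "linear \<mu>"
  shows "schaback_w \<mu> = kernel_poly (kappa \<mu>) \<mu>"
proof (rule rpoly_eqI)
  fix x :: "real ^ 'd"
  let ?k = "kappa \<mu>"
  have "dist_poly ?k x = (\<Sum>b\<le>?k. \<Sum>a\<le>?k - b. \<Sum>w\<in>words b.
      (real (?k choose b) * real ((?k - b) choose a) * (- 2) ^ b * poly_at (radial a w) x) *\<^sub>R
        radial (?k - b - a) w)"
    by (rule rpoly_eqI)
      (simp add: dist_poly.rep_eq dist_power_expansion poly_at_sum scaleR_rpoly.rep_eq mult.assoc)
  then show "poly_at (schaback_w \<mu>) x = poly_at (kernel_poly ?k \<mu>) x"
    by (simp add: poly_at_schaback_w[OF assms] kernel_poly_def poly_at_sum scaleR_rpoly.rep_eq
        linear_sum[OF assms] linear_scale[OF assms] mult_ac)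
qed

lemma kernel_poly_in_poly_less:
  assumes "\<mu> \<in> annihilator (poly_less k)"
  shows "kernel_poly k \<mu> \<in> poly_less (Suc k)"
proof -
  have *: "(real (k choose b) * real ((k - b) choose a) * (- 2) ^ b * \<mu> (radial (k - b - a) w)) *\<^sub>R
      radial a w \<in> span {monomial \<alpha> | \<alpha>. (\<Sum>i\<in>UNIV. \<alpha> i) < Suc k}"
    if "b \<le> k" "a \<le> k - b" "w \<in> words b" for a b w
  proof (cases "2 * a + b \<le> k")
    case True
    then show ?thesis
      using that radial_in_poly_less[of a w "Suc k"]
      by (intro span_scale) (auto simp: words_def poly_less_def)
  next
    case False
    \<comment> \<open>The degrees 2a + b and 2(k - b - a) + b add up to 2k, so if the first exceeds
      k, the second is below k.\<close>
    then have "radial (k - b - a) w \<in> poly_less k"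
      using that by (intro radial_in_poly_less) (auto simp: words_def)
    then have "\<mu> (radial (k - b - a) w) = 0"
      using assms by (simp add: annihilator_def)
    then show ?thesis by (simp add: span_zero)
  qed
  show ?thesis
    unfolding kernel_poly_def poly_less_def by (intro span_sum *) auto
qed

text \<open>With k fixed instead of read off from \<open>kappa\<close>, the construction is linear
  in the functional. A whole block of the Gram matrix thus becomes one quadratic form.\<close>

lemma kernel_poly_sum:
  fixes \<mu> :: "'i \<Rightarrow> 'd::finite rpoly \<Rightarrow> real"
  shows "kernel_poly k (\<Sum>j\<in>J. c j *\<^sub>R \<mu> j) = (\<Sum>j\<in>J. c j *\<^sub>R kernel_poly k (\<mu> j))"
proof -
  have "kernel_poly k (\<mu> + \<nu>) = kernel_poly k \<mu> + kernel_poly k \<nu>" for \<mu> \<nu> :: "'d rpoly \<Rightarrow> real"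
    by (simp add: kernel_poly_def algebra_simps sum.distrib)
  moreover have "kernel_poly k (r *\<^sub>R \<mu>) = r *\<^sub>R kernel_poly k \<mu>" for r and \<mu> :: "'d rpoly \<Rightarrow> real"
    by (simp add: kernel_poly_def scaleR_sum_right mult_ac)
  ultimately have "linear (kernel_poly k :: ('d rpoly \<Rightarrow> real) \<Rightarrow> _)"
    by (intro linearI) auto
  then show ?thesis by (simp add: linear_sum linear_scale)
qed

text \<open>Up to the sign (-1)^k, the value is a sum of nonnegative terms. If it is zero, all of
  them are, in particular the squares of the values at the monomials of degree k.\<close>

lemma kernel_poly_definite:
  fixes \<mu> :: "'d::finite rpoly \<Rightarrow> real"
  assumes \<mu>: "\<mu> \<in> annihilator (poly_less k)" and zero: "\<mu> (kernel_poly k \<mu>) = 0"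
  shows "\<mu> \<in> annihilator (poly_less (Suc k))"
proof -
  have lin: "linear \<mu>" using \<mu> by (simp add: annihilator_poly_less_iff)
  define t where "t b a w = (- 1) ^ k * (real (k choose b) * real ((k - b) choose a) * (- 2) ^ b *
      \<mu> (radial (k - b - a) w) * \<mu> (radial a w))" for b a and w :: "'d list"
  have nonneg: "t b a w \<ge> 0" if "b \<le> k" "a \<le> k - b" "w \<in> words b" for b a w
  proof (cases "k - b - a = a")
    case True
    \<comment> \<open>Here k - b = 2a, so the signs (-1)^k and (-1)^b cancel and a square
      remains.\<close>
    then have "even (k + b)" using that by presburger
    then have "(- 1) ^ k * (- 2 :: real) ^ b = 2 ^ b"
      using power_minus[of "2 :: real" b] by (simp flip: power_add mult.assoc)
    then have "t b a w = real (k choose b) * real ((k - b) choose a) * 2 ^ b * (\<mu> (radial a w))\<^sup>2"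
      unfolding t_def True by (simp add: power2_eq_square mult_ac)
    then show ?thesis by simp
  next
    case False
    \<comment> \<open>Two different degrees with sum 2k: the smaller one is below k, and the
      functional kills that factor.\<close>
    then have "2 * a + b < k \<or> 2 * (k - b - a) + b < k"
      using that by linarith
    then have "radial a w \<in> poly_less k \<or> radial (k - b - a) w \<in> poly_less k"
      using that radial_in_poly_less[of a w k] radial_in_poly_less[of "k - b - a" w k]
      by (auto simp: words_def)
    then have "\<mu> (radial a w) = 0 \<or> \<mu> (radial (k - b - a) w) = 0"
      using \<mu> by (auto simp: annihilator_def)
    then show ?thesis by (auto simp: t_def)
  qed
  have "(\<Sum>b\<le>k. \<Sum>a\<le>k - b. \<Sum>w\<in>words b. t b a w) = (- 1) ^ k * \<mu> (kernel_poly k \<mu>)"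
    by (simp add: kernel_poly_def t_def linear_sum[OF lin] linear_scale[OF lin] sum_distrib_left)
  then have "(\<Sum>b\<le>k. \<Sum>a\<le>k - b. \<Sum>w\<in>words b. t b a w) = 0"
    using zero by simp
  then have "\<forall>b\<in>{..k}. (\<Sum>a\<le>k - b. \<Sum>w\<in>words b. t b a w) = 0"
    by (subst (asm) sum_nonneg_eq_0_iff) (auto intro!: sum_nonneg nonneg)
  \<comment> \<open>The choice b = k forces a = 0, and the terms left are 2^k times squares of
    values at word monomials of degree k.\<close>
  from bspec[OF this, of k] have "(\<Sum>w\<in>words k. t k 0 w) = 0" by simp
  then have "\<forall>w\<in>words k. t k 0 w = 0"
    by (subst (asm) sum_nonneg_eq_0_iff) (auto intro!: nonneg simp: finite_words)
  then have words: "\<mu> (monomial (count_list w)) = 0" if "length w = k" for w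
    using that by (auto simp: t_def radial_0 words_def)
  have "\<mu> (monomial \<alpha>) = 0" if "(\<Sum>i\<in>UNIV. \<alpha> i) < Suc k" for \<alpha>
  proof (cases "(\<Sum>i\<in>UNIV. \<alpha> i) < k")
    case True
    then show ?thesis using \<mu> by (simp add: annihilator_poly_less_iff)
  next
    case False
    \<comment> \<open>Any exponent vector is a multiset of variables, and listing it gives a word
      with these letter counts.\<close>
    obtain w where "mset w = Abs_multiset \<alpha>" using ex_mset by blast
    then have "count (mset w) = \<alpha>" by simp
    then have "count_list w = \<alpha>" by (simp add: fun_eq_iff count_mset)
    then show ?thesis
      using words[of w] sum_count_list[of w] False that by simp
  qed
  then show ?thesis using lin by (simp add: annihilator_poly_less_iff)
qed


subsection \<open>Invertibility of the Gram matrix\<close>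

text \<open>By gradedness the combination lies in the span of the basis elements with
  \<open>kappa\<close> at least k. These are disjoint from J, so a nonzero coefficient would
  contradict independence.\<close>

lemma graded_basis_coeff_eq_0:
  assumes "graded_basis l M"
    and "(\<Sum>j\<in>J. c j *\<^sub>R l j) \<in> annihilator (poly_less k)"
    and J: "\<And>j. j \<in> J \<Longrightarrow> kappa (l j) < k"
    and j: "j \<in> J"
  shows "c j = 0"
proof (rule ccontr)
  assume "c j \<noteq> 0"
  have inj: "inj l" and indep: "independent (range l)" and M: "span (range l) = M"
    and part: "span (l ` {i. kappa (l i) \<ge> k}) = M \<inter> annihilator (poly_less k)"
    using assms(1) by (auto simp: graded_basis_def is_basis_def)
  have "(\<Sum>j\<in>J. c j *\<^sub>R l j) \<in> M"
    unfolding M[symmetric] by (intro span_sum span_scale span_base) auto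
  then have "(\<Sum>j\<in>J. c j *\<^sub>R l j) \<in> span (l ` {i. kappa (l i) \<ge> k})"
    using assms(2) part by simp
  also have "\<dots> \<subseteq> span (l ` (UNIV - {j}))"
    using J[OF j] by (intro span_mono) auto
  finally have "(\<Sum>j\<in>J. c j *\<^sub>R l j) \<in> span (l ` (UNIV - {j}))" .
  moreover have "(\<Sum>i\<in>J - {j}. c i *\<^sub>R l i) \<in> span (l ` (UNIV - {j}))"
    by (intro span_sum span_scale span_base) auto
  ultimately have "(\<Sum>j\<in>J. c j *\<^sub>R l j) - (\<Sum>i\<in>J - {j}. c i *\<^sub>R l i) \<in> span (l ` (UNIV - {j}))"
    by (rule span_diff)
  then have "c j *\<^sub>R l j \<in> span (l ` (UNIV - {j}))"
    using j by (simp add: sum.remove[of J j])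
  then have "(1 / c j) *\<^sub>R c j *\<^sub>R l j \<in> span (l ` (UNIV - {j}))"
    by (rule span_scale)
  then have "l j \<in> span (l ` (UNIV - {j}))"
    using \<open>c j \<noteq> 0\<close> by simp
  moreover have "l ` (UNIV - {j}) = range l - {l j}"
    using inj by (auto simp: inj_def)
  ultimately show False using indep by (auto simp: dependent_def)
qed

lemma schaback_W_axis: "schaback_W l (axis j 1) = schaback_w (l j)"
  by (simp add: schaback_W_def axis_def if_distrib[of "\<lambda>c. c *\<^sub>R _"] cong: if_cong)

lemma linear_schaback_W: "linear (schaback_W l)"
  by (rule linearI) (simp_all add: schaback_W_def scaleR_add_left sum.distrib scaleR_sum_right)

lemma data_map_schaback_W:
  assumes "\<And>i. linear (l i)"
  shows "data_map l (schaback_W l a) = schaback_gram l *v a"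
  by (simp add: vec_eq_iff data_map_def schaback_W_def schaback_gram_def matrix_vector_mult_def
      linear_sum[OF assms] linear_scale[OF assms] mult.commute)

lemma graded_basis_linear:
  assumes "M \<subseteq> alg_dual" "graded_basis l M"
  shows "linear (l i)"
proof -
  have "l i \<in> M"
    using assms(2) span_base[of "l i" "range l"] by (auto simp: graded_basis_def is_basis_def)
  then show ?thesis using assms(1) by (auto simp: alg_dual_def)
qed

lemma graded_basis_annihilator_kappa:
  assumes "M \<subseteq> alg_dual" "graded_basis l M"
  shows "l i \<in> annihilator (poly_less (kappa (l i)))"
proof (rule annihilator_kappa)
  show "linear (l i)" using assms by (rule graded_basis_linear)
  show "l i \<noteq> 0"
    using assms(2) dependent_zero[of "range l"] by (metis graded_basis_def is_basis_def rangeI)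
qed

lemma schaback_w_in_poly_less:
  assumes "M \<subseteq> alg_dual" "graded_basis l M" "kappa (l j) < k"
  shows "schaback_w (l j) \<in> poly_less k"
  using kernel_poly_in_poly_less[OF graded_basis_annihilator_kappa[OF assms(1,2)], of j]
    poly_less_mono[of "Suc (kappa (l j))" k] assms(3)
  by (auto simp: schaback_w_eq_kernel_poly graded_basis_linear[OF assms(1,2)])

text \<open>Let k be the largest \<open>kappa\<close> carrying a nonzero coefficient. In the rows of
  that block only the diagonal block contributes, so the quadratic form of \<mu>, the combination
  over the block, vanishes. Definiteness and gradedness then make all coefficients of the block
  zero, against the choice of k.\<close>

lemma schaback_gram_kernel:
  assumes M: "M \<subseteq> alg_dual" "graded_basis l M" and "schaback_gram l *v a = 0"
  shows "a = 0"
proof (rule ccontr)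
  assume "a \<noteq> 0"
  define k where "k = Max {kappa (l j) | j. a $ j \<noteq> 0}"
  define J where "J = {j. kappa (l j) = k}"
  have fin: "finite {kappa (l j) | j. a $ j \<noteq> 0}"
    by (rule finite_subset[of _ "range (\<lambda>j. kappa (l j))"]) auto
  have "{kappa (l j) | j. a $ j \<noteq> 0} \<noteq> {}"
    using \<open>a \<noteq> 0\<close> by (auto simp: vec_eq_iff)
  then have "k \<in> {kappa (l j) | j. a $ j \<noteq> 0}"
    unfolding k_def using fin by (intro Max_in)
  then obtain j0 where j0: "a $ j0 \<noteq> 0" "j0 \<in> J" by (auto simp: J_def)
  have small: "kappa (l j) < k" if "a $ j \<noteq> 0" "j \<notin> J" for j
  proof -
    have "kappa (l j) \<le> k"
      unfolding k_def using fin that(1) by (intro Max_ge) auto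
    then show ?thesis using that(2) by (simp add: J_def)
  qed
  note lin = graded_basis_linear[OF M] and ann = graded_basis_annihilator_kappa[OF M]
  define \<mu> where "\<mu> = (\<Sum>j\<in>J. a $ j *\<^sub>R l j)"
  have \<mu>: "\<mu> \<in> annihilator (poly_less k)"
  proof -
    have "l j \<in> annihilator (poly_less k)" if "j \<in> J" for j
      using ann[of j] that by (simp add: J_def)
    then show ?thesis
      unfolding \<mu>_def by (intro subspace_sum subspace_scale subspace_annihilator)
  qed
  have row: "l i (kernel_poly k \<mu>) = 0" if "i \<in> J" for i
  proof -
    \<comment> \<open>Columns with larger \<open>kappa\<close> have coefficient 0; those with
      smaller \<open>kappa\<close> hold polynomials of degree below k, which the row functional
      kills.\<close>
    have "a $ j * l i (schaback_w (l j)) = 0" if "j \<notin> J" for j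
    proof (cases "a $ j = 0")
      case False
      then have "schaback_w (l j) \<in> poly_less k"
        using small that by (intro schaback_w_in_poly_less[OF M])
      then show ?thesis using ann[of i] \<open>i \<in> J\<close> by (simp add: J_def annihilator_def)
    qed simp
    then have "(\<Sum>j\<in>J. a $ j * l i (schaback_w (l j))) = (\<Sum>j\<in>UNIV. a $ j * l i (schaback_w (l j)))"
      by (intro sum.mono_neutral_left) auto
    also have "\<dots> = (schaback_gram l *v a) $ i"
      by (simp add: schaback_gram_def matrix_vector_mult_def mult.commute)
    finally have "(\<Sum>j\<in>J. a $ j * l i (schaback_w (l j))) = 0"
      using assms(3) by simp
    moreover have "schaback_w (l j) = kernel_poly k (l j)" if "j \<in> J" for j
      using that lin by (simp add: schaback_w_eq_kernel_poly J_def)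
    ultimately show ?thesis
      by (simp add: \<mu>_def kernel_poly_sum linear_sum[OF lin] linear_scale[OF lin])
  qed
  have "\<mu> (kernel_poly k \<mu>) = (\<Sum>j\<in>J. a $ j * l j (kernel_poly k \<mu>))"
    by (subst (1) \<mu>_def) (simp add: sum_fun_apply)
  also have "\<dots> = 0" using row by simp
  finally have "\<mu> \<in> annihilator (poly_less (Suc k))"
    by (rule kernel_poly_definite[OF \<mu>])
  \<comment> \<open>Applied at level k + 1, since the block consists of functionals with
    \<open>kappa\<close> equal to k.\<close>
  then have "a $ j0 = 0"
    unfolding \<mu>_def by (rule graded_basis_coeff_eq_0[OF M(2)]) (use j0 in \<open>auto simp: J_def\<close>)
  then show False using j0 by simp
qed


subsection \<open>Minimal degree\<close>

text \<open>The space of polynomials is infinite-dimensional, so the finiteness of a basis has to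
  come from the enclosing span of B.\<close>

lemma finite_dim_subspace_basis:
  assumes "V \<subseteq> span B" "finite B"
  obtains C where "finite C" "independent C" "C \<subseteq> V" "V \<subseteq> span C" "dim V = card C"
proof -
  obtain C where C: "C \<subseteq> V" "independent C" "V \<subseteq> span C" "card C = dim V"
    using basis_exists[of V] by blast
  then have "finite C"
    using independent_span_bound[of B C] assms by auto
  then show thesis using C that by simp
qed

lemma independent_axis: "independent ((\<lambda>i. axis i (1::real)) ` (I :: 'n::finite set))"
  by (rule independent_mono[OF independent_Basis]) (auto simp: Basis_vec_def)

theorem mainTheorem5:
  fixes M :: "('d::finite rpoly \<Rightarrow> real) set"
    and l :: "'n::{finite,linorder} \<Rightarrow> 'd rpoly \<Rightarrow> real"
  assumes "M \<subseteq> alg_dual"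
    and "subspace M"
    and "dim M = CARD('n)"
    and "graded_basis l M"
  shows "minimal_degree (schaback_projector l)"
proof -
  let ?P = "schaback_projector l" and ?W = "schaback_W l" and ?A = "schaback_gram l"
  note lin = graded_basis_linear[OF assms(1,4)]
  have ker: "a = 0" if "?A *v a = 0" for a
    using schaback_gram_kernel[OF assms(1,4) that] .
  then have "invertible ?A"
    by (simp add: invertible_left_inverse matrix_left_invertible_ker)
  then have inv: "matrix_inv ?A ** ?A = mat 1"
    unfolding matrix_inv_def invertible_def by (rule someI_ex[THEN conjunct2])
  \<comment> \<open>The data of \<open>?W a\<close> are \<open>?A *v a\<close>, which the inverse
    matrix takes back to a. Both idempotence and the range of the projector follow from
    this.\<close>
  have PW: "?P (?W a) = ?W a" for a
    by (simp add: schaback_projector_def data_map_schaback_W[OF lin] matrix_vector_mul_assoc inv)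
  have inj_W: "inj ?W"
  proof -
    have "a = 0" if "?W a = 0" for a
    proof -
      have "?A *v a = data_map l 0"
        using that data_map_schaback_W[of l a, OF lin] by simp
      also have "\<dots> = 0"
        by (simp add: data_map_def vec_eq_iff linear_0[OF lin])
      finally show ?thesis by (rule ker)
    qed
    then show ?thesis by (simp add: linear_injective_0[OF linear_schaback_W])
  qed
  have lin_data: "linear (data_map l)"
    by (rule linearI) (simp_all add: data_map_def vec_eq_iff linear_add[OF lin] linear_scale[OF lin])
  have lin_P: "linear ?P"
    unfolding schaback_projector_def
    using linear_compose[OF linear_compose[OF lin_data matrix_vector_mul_linear] linear_schaback_W]
    by (simp add: o_def)
  have range_P: "range ?P = range ?W"
  proof
    show "range ?P \<subseteq> range ?W" by (auto simp: schaback_projector_def)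
    show "range ?W \<subseteq> range ?P" by (metis PW image_subsetI rangeI)
  qed
  have "range ?W = span (?W ` Basis)"
    by (simp add: linear_span_image[OF linear_schaback_W])
  then have "finite_rank_projector ?P"
    unfolding finite_rank_projector_def
    using lin_P range_P PW
    by (auto simp: schaback_projector_def fun_eq_iff intro!: exI[of _ "?W ` Basis"])
  moreover have "dim (G \<inter> poly_less k) \<le> dim (range ?P \<inter> poly_less k)"
    if G: "subspace G" "correct_for G (annihilator {p. ?P p = 0})" for G k
  proof -
    let ?I = "{i. kappa (l i) < k}"
    \<comment> \<open>The unit vectors of the data components with \<open>kappa\<close> below k.
      Their number separates the two dimensions to be compared.\<close>
    let ?E = "(\<lambda>i. axis i (1::real)) ` ?I :: (real, 'n) vec set"
    obtain B :: "'d rpoly set" where B: "finite B" "poly_less k = span B"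
      using finite_dim_poly_less by blast
    obtain C where C: "finite C" "independent C" "C \<subseteq> G \<inter> poly_less k"
        "dim (G \<inter> poly_less k) = card C"
      using finite_dim_subspace_basis[of "G \<inter> poly_less k" B] B by (metis inf_le2)
    obtain D where D: "finite D" "range ?P \<inter> poly_less k \<subseteq> span D"
        "dim (range ?P \<inter> poly_less k) = card D"
      using finite_dim_subspace_basis[of "range ?P \<inter> poly_less k" B] B by (metis inf_le2)
    have "span C \<subseteq> G"
      using C(3) G(1) by (intro span_minimal) auto
    \<comment> \<open>An element with zero data lies in the kernel of the projector, so no
      functional in the annihilator of that kernel tells it from 0. Both lie in G, and the
      uniqueness in correctness identifies them.\<close>
    have ker_data: "g = 0" if "g \<in> span C" "data_map l g = 0" for g
    proof -
      have "?P g = 0"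
        using that by (simp add: schaback_projector_def linear_0[OF linear_schaback_W])
      then have "\<forall>\<mu>\<in>annihilator {p. ?P p = 0}. \<mu> g = \<mu> 0"
        by (auto simp: annihilator_def alg_dual_def linear_0)
      moreover have "g \<in> G" "0 \<in> G"
        using \<open>span C \<subseteq> G\<close> that(1) subspace_0[OF G(1)] by auto
      ultimately show ?thesis
        using G(2) unfolding correct_for_def by blast
    qed
    then have inj: "inj_on (data_map l) (span C)"
      by (simp add: linear_inj_on_iff_eq_0[OF lin_data])
    have "data_map l g \<in> span ?E" if "g \<in> C" for g
    proof -
      \<comment> \<open>These functionals vanish below degree \<open>kappa (l i)\<close>, which is
        at least k.\<close>
      have "l i g = 0" if "i \<notin> ?I" for i
      proof -
        have "g \<in> poly_less (kappa (l i))"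
          using \<open>g \<in> C\<close> C(3) poly_less_mono[of k "kappa (l i)"] that by auto
        then show ?thesis
          using graded_basis_annihilator_kappa[OF assms(1,4), of i] by (simp add: annihilator_def)
      qed
      then have "(\<Sum>i\<in>?I. l i g *\<^sub>R axis i 1) = (\<Sum>i\<in>UNIV. l i g *\<^sub>R axis i 1 :: (real, 'n) vec)"
        by (intro sum.mono_neutral_left) auto
      also have "\<dots> = data_map l g"
        using basis_expansion[of "data_map l g"] by (simp add: scalar_mult_eq_scaleR data_map_def)
      finally show ?thesis
        by (metis (no_types, lifting) imageI span_base span_scale span_sum)
    qed
    moreover have "independent (data_map l ` C)"
      using linear_independent_injective_image[OF lin_data C(2) inj] .
    ultimately have "card (data_map l ` C) \<le> card ?E"
      using independent_span_bound[of ?E "data_map l ` C"] by auto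
    moreover have "card (data_map l ` C) = card C"
      using inj span_superset by (intro card_image) (rule inj_on_subset)
    moreover have "card ?E \<le> card D"
    proof -
      \<comment> \<open>The image of the unit vectors under \<open>?W\<close> is the family of all
        w_j with \<open>kappa\<close> below k.\<close>
      have "independent (?W ` ?E)"
        using independent_axis inj_W
        by (intro linear_independent_injective_image[OF linear_schaback_W]) (auto intro: inj_on_subset)
      moreover have "?W ` ?E \<subseteq> range ?P \<inter> poly_less k"
        using schaback_w_in_poly_less[OF assms(1,4)]
        by (auto simp: range_P schaback_W_axis)
      then have "?W ` ?E \<subseteq> span D"
        using D(2) by (rule subset_trans)
      moreover have "card (?W ` ?E) = card ?E"
        using inj_W by (intro card_image) (auto intro: inj_on_subset)
      ultimately show ?thesis
        using independent_span_bound[of D "?W ` ?E"] D(1) by simp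
    qed
    ultimately show ?thesis using C(4) D(3) by simp
  qed
  ultimately show ?thesis by (simp add: minimal_degree_def)
qed

end
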